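(* Let $k\geq 1$ and let $\mathcal{G}$ be a class of graphs such that every $G\in\mathcal{G}$ satisfies $\Delta(G)\leq\delta(G)^k$. Then there exists a constant $c_{\mathcal{G},k}$ such that for every $G\in\mathcal{G}$ on $n$ vertices with minimum degree $\delta$, \[\overset{\rightarrow}{\gamma}_{LD}(G)\leq c_{\mathcal{G},k}\cdot\frac{\log\delta}{\delta}\cdot n.\]
   Context: All graphs are finite and simple; $\Delta(G)$ and $\delta(G)$ denote maximum and minimum degree; logarithms are base 2. For an orientation $D$ of $G=(V,E)$ (each edge given exactly one direction), a set $S\subseteq V$ is locating-dominating in $D$ if every $u\notin S$ has an in-neighbour in $S$ and distinct $u,v\notin S$ have distinct sets of in-neighbours in $S$; $\gamma_{LD}(D)$ is the minimum size of such a set. $\overset{\rightarrow}{\gamma}_{LD}(G)$ is the minimum of $\gamma_{LD}(D)$ over all orientations $D$ of $G$.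
   Formalization: The bound is asserted only for graphs in the class with minimum degree δ ≥ 2: for δ = 1 (perfect matchings, e.g. K_2) the right-hand side is 0 and the claim is false, and for δ = 0 the expression (log δ)/δ is undefined. *)

theory Defs
  imports Complex_Main "Graph_Theory.Pair_Digraph"
begin

(* A finite simple graph is a pair_graph: finite vertex set, and a symmetric irreflexive arc
   relation containing both (u,v) and (v,u) for each edge uv.  Hence the number of edges at v
   is out_degree G v, and an arc (u,v) of a digraph has tail u and head v. *)

definition max_degree :: "'a pair_pre_digraph \<Rightarrow> nat" where
  "max_degree G = Max (out_degree (with_proj G) ` pverts G)"

definition min_degree :: "'a pair_pre_digraph \<Rightarrow> nat" where
  "min_degree G = Min (out_degree (with_proj G) ` pverts G)"

definition orientation_of :: "'a pair_pre_digraph \<Rightarrow> 'a pair_pre_digraph \<Rightarrow> bool" where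
  "orientation_of D G \<longleftrightarrow>
     pverts D = pverts G \<and>
     parcs D \<union> (parcs D)\<inverse> = parcs G \<and>
     parcs D \<inter> (parcs D)\<inverse> = {}"

definition in_nbrs :: "'a pair_pre_digraph \<Rightarrow> 'a \<Rightarrow> 'a set" where
  "in_nbrs D u = {v. (v, u) \<in> parcs D}"

definition locating_dominating :: "'a pair_pre_digraph \<Rightarrow> 'a set \<Rightarrow> bool" where
  "locating_dominating D S \<longleftrightarrow>
     S \<subseteq> pverts D \<and>
     (\<forall>u \<in> pverts D - S. in_nbrs D u \<inter> S \<noteq> {}) \<and>
     (\<forall>u \<in> pverts D - S. \<forall>v \<in> pverts D - S.
        u \<noteq> v \<longrightarrow> in_nbrs D u \<inter> S \<noteq> in_nbrs D v \<inter> S)"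

definition gamma_LD :: "'a pair_pre_digraph \<Rightarrow> nat" where
  "gamma_LD D = (LEAST m. \<exists>S. locating_dominating D S \<and> card S = m)"

definition oriented_gamma_LD :: "'a pair_pre_digraph \<Rightarrow> nat" where
  "oriented_gamma_LD G = (LEAST m. \<exists>D. orientation_of D G \<and> gamma_LD D = m)"

(* Both minima range over nonempty sets. *)

lemma locating_dominating_verts: "locating_dominating D (pverts D)"
  by (simp add: locating_dominating_def)

lemma orientation_exists:
  assumes "pair_graph G"
  shows "\<exists>D. orientation_of D G"
proof -
  interpret pair_graph G by (rule assms)
  obtain f :: "'a \<Rightarrow> nat" where f: "inj_on f (pverts G)"
    using finite_imp_inj_to_nat_seg pair_finite_verts by metis
  have sym: "(v, u) \<in> parcs G" if "(u, v) \<in> parcs G" for u v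
    using pair_sym_arcs that by (auto simp: symmetric_def dest: symD)
  have ne: "f u \<noteq> f v" if "(u, v) \<in> parcs G" for u v
    using f that wellformed'[OF that] pair_no_loops[OF that] by (auto dest: inj_onD)
  have "orientation_of \<lparr>pverts = pverts G, parcs = {(u, v) \<in> parcs G. f u < f v}\<rparr> G"
    unfolding orientation_of_def using sym ne by (fastforce simp: neq_iff)
  then show ?thesis ..
qed

end

theory Submission
  imports Defs
begin

text \<open>
  Put every vertex into $S$ independently with probability $p = 4m/\delta$, where
  $m \approx (2k+2)\log\delta$. A Chernoff-type bound shows that few vertices have fewer than $m$
  neighbours in $S$. Orient the edges between $S$ and its complement by fair coin flips. For a vertex
  $u \notin S$ with at least $m$ neighbours in $S$, the in-neighbourhood in $S$ is empty or coincides
  with that of a given other vertex with probability at most $2^{-m}$. Equal nonempty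
  in-neighbourhoods force a common neighbour, so only $\Delta^2 \le \delta^{2k}$ other vertices
  matter and a union bound suffices. Finally all offending vertices are added to $S$, which cannot
  destroy any distinction already made.
\<close>

section \<open>Random choice of a set meeting most neighbourhoods often\<close>

text \<open>First moment method without a probability space: expectations are finite weighted sums,
  and some outcome does not exceed the mean.\<close>

lemma weighted_average_le:
  fixes w F :: "'b \<Rightarrow> real"
  assumes "finite I" and "\<And>i. i \<in> I \<Longrightarrow> 0 \<le> w i" and "0 < sum w I"
    and "(\<Sum>i\<in>I. w i * F i) \<le> B * sum w I"
  obtains i where "i \<in> I" "F i \<le> B"
proof -
  have "\<exists>i\<in>I. F i \<le> B"
  proof (rule ccontr)
    assume "\<not> ?thesis"
    then have gt: "B < F i" if "i \<in> I" for i
      using that by force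
    have "(\<Sum>i\<in>I. w i * (F i - B)) = (\<Sum>i\<in>I. w i * F i) - B * sum w I"
      by (simp add: algebra_simps sum_subtractf sum_distrib_left)
    then have "(\<Sum>i\<in>I. w i * (F i - B)) \<le> 0"
      using assms(4) by simp
    moreover have nonneg: "0 \<le> w i * (F i - B)" if "i \<in> I" for i
      using assms(2) gt that by (simp add: less_imp_le)
    ultimately have "(\<Sum>i\<in>I. w i * (F i - B)) = 0"
      by (meson order_antisym sum_nonneg)
    then have "\<forall>i\<in>I. w i * (F i - B) = 0"
      using nonneg assms(1) by (simp add: sum_nonneg_eq_0_iff)
    then have "\<forall>i\<in>I. w i = 0"
      using gt by fastforce
    then show False
      using assms(3) by simp
  qed
  then show ?thesis
    using that by blast
qed

text \<open>Independence in generating-function form: expanding the right-hand product chooses, for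
  each v, membership in S or in its complement. Every expectation over the random set below is
  obtained by a suitable choice of \<open>g\<close>.\<close>

lemma sum_Pow_bernoulli:
  fixes p :: real
  assumes "finite V"
  shows "(\<Sum>S\<in>Pow V. p ^ card S * (1 - p) ^ card (V - S) * (\<Prod>v\<in>S. g v))
    = (\<Prod>v\<in>V. p * g v + (1 - p))"
  by (simp add: prod_add[OF assms] prod.distrib mult_ac)

text \<open>\<open>S\<close> is a random set with inclusion probability \<open>p\<close>. Markov's
  inequality applied to 2 to the power -|S \<inter> N u| bounds the chance of fewer than
  \<open>m\<close> neighbours, and linearity of expectation adds this over all u to the expected
  size of \<open>S\<close>.\<close>

lemma sparse_multiply_dominating_set:
  fixes p :: real and N :: "'b \<Rightarrow> 'b set"
  assumes V: "finite V" and p: "0 \<le> p" "p \<le> 1"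
    and N: "\<And>u. u \<in> V \<Longrightarrow> N u \<subseteq> V" and deg: "\<And>u. u \<in> V \<Longrightarrow> d \<le> card (N u)"
  obtains S where "S \<subseteq> V"
    "real (card S) + real (card {u \<in> V. card (S \<inter> N u) < m})
      \<le> real (card V) * (p + 2 ^ m * (1 - p / 2) ^ d)"
proof -
  define w where "w S = p ^ card S * (1 - p) ^ card (V - S)" for S
  define F where "F S = real (card S) + real (card {u \<in> V. card (S \<inter> N u) < m})" for S
  have gen: "(\<Sum>S\<in>Pow V. w S * (\<Prod>v\<in>S. g v)) = (\<Prod>v\<in>V. p * g v + (1 - p))" for g
    unfolding w_def by (rule sum_Pow_bernoulli[OF V])
  have w0: "0 \<le> w S" for S
    using p by (simp add: w_def)
  have w1: "sum w (Pow V) = 1"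
    using gen[of "\<lambda>_. 1"] by simp
  have mem: "(\<Sum>S\<in>Pow V. w S * of_bool (v \<in> S)) = p" if "v \<in> V" for v
  proof -
    \<comment> \<open>Membership is not itself a product over S, but non-membership is, which brings
      it into the scope of \<open>gen\<close>.\<close>
    have "of_bool (v \<in> S) = 1 - (\<Prod>x\<in>S. of_bool (x \<noteq> v) :: real)" if "S \<in> Pow V" for S
      using that finite_subset[OF _ V, of S] by (auto simp: prod_zero_iff intro!: prod.neutral)
    then have "(\<Sum>S\<in>Pow V. w S * of_bool (v \<in> S))
        = (\<Sum>S\<in>Pow V. w S * (1 - (\<Prod>x\<in>S. of_bool (x \<noteq> v))))"
      by (intro sum.cong) auto
    also have "\<dots> = 1 - (\<Sum>S\<in>Pow V. w S * (\<Prod>x\<in>S. of_bool (x \<noteq> v)))"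
      by (simp add: algebra_simps sum_subtractf w1)
    also have "(\<Sum>S\<in>Pow V. w S * (\<Prod>x\<in>S. of_bool (x \<noteq> v)))
        = (\<Prod>x\<in>V. if x = v then 1 - p else 1)"
      unfolding gen by (intro prod.cong) auto
    also have "\<dots> = 1 - p"
      using that V by simp
    finally show ?thesis
      by simp
  qed
  have few: "(\<Sum>S\<in>Pow V. w S * of_bool (card (S \<inter> N u) < m)) \<le> 2 ^ m * (1 - p / 2) ^ d"
    if u: "u \<in> V" for u
  proof -
    \<comment> \<open>Exponential moment with base 1/2: each neighbour in S halves the product, so
      fewer than \<open>m\<close> halvings leave the right side at least 1.\<close>
    have "of_bool (card (S \<inter> N u) < m) \<le> 2 ^ m * (\<Prod>x\<in>S. if x \<in> N u then 1 / 2 else 1 :: real)"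
      if "S \<in> Pow V" for S
    proof -
      have fin: "finite S"
        using that V finite_subset by auto
      have "(\<Prod>x\<in>S. if x \<in> N u then 1 / 2 else 1 :: real) = (1 / 2) ^ card (S \<inter> N u)"
        using fin by (simp add: prod.If_cases Collect_mem_eq)
      moreover have "1 \<le> 2 ^ m * (1 / 2 :: real) ^ card (S \<inter> N u)" if "card (S \<inter> N u) < m"
        using that by (simp add: power_divide)
      ultimately show ?thesis
        by simp
    qed
    then have "(\<Sum>S\<in>Pow V. w S * of_bool (card (S \<inter> N u) < m))
        \<le> (\<Sum>S\<in>Pow V. w S * (2 ^ m * (\<Prod>x\<in>S. if x \<in> N u then 1 / 2 else 1)))"
      by (intro sum_mono mult_left_mono w0)
    also have "\<dots> = 2 ^ m * (\<Prod>x\<in>V. p * (if x \<in> N u then 1 / 2 else 1) + (1 - p))"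
      unfolding gen[symmetric] by (simp add: sum_distrib_left mult_ac)
    also have "(\<Prod>x\<in>V. p * (if x \<in> N u then 1 / 2 else 1) + (1 - p))
        = (\<Prod>x\<in>V. if x \<in> N u then 1 - p / 2 else 1)"
      by (intro prod.cong) auto
    also have "\<dots> = (1 - p / 2) ^ card (N u)"
      using V N[OF u] by (simp add: prod.If_cases Int_absorb1)
    also have "2 ^ m * \<dots> \<le> 2 ^ m * (1 - p / 2) ^ d"
      using p deg[OF u] by (intro mult_left_mono power_decreasing) auto
    finally show ?thesis .
  qed
  have "(\<Sum>S\<in>Pow V. w S * F S)
      = (\<Sum>S\<in>Pow V. \<Sum>u\<in>V. w S * of_bool (u \<in> S) + w S * of_bool (card (S \<inter> N u) < m))"
  proof (rule sum.cong)
    fix S assume "S \<in> Pow V"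
    then have "real (card S) = (\<Sum>u\<in>V. of_bool (u \<in> S))"
      using V by (simp add: of_bool_def sum.If_cases Int_absorb1)
    moreover have "real (card {u \<in> V. card (S \<inter> N u) < m})
        = (\<Sum>u\<in>V. of_bool (card (S \<inter> N u) < m))"
      using V by (simp add: of_bool_def sum.If_cases Int_def)
    ultimately show "w S * F S
        = (\<Sum>u\<in>V. w S * of_bool (u \<in> S) + w S * of_bool (card (S \<inter> N u) < m))"
      by (simp only: F_def sum_distrib_left sum.distrib distrib_left)
  qed simp
  also have "\<dots> = (\<Sum>u\<in>V. \<Sum>S\<in>Pow V. w S * of_bool (u \<in> S) + w S * of_bool (card (S \<inter> N u) < m))"
    by (rule sum.swap)
  also have "\<dots> \<le> (\<Sum>u\<in>V. p + 2 ^ m * (1 - p / 2) ^ d)"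
    unfolding sum.distrib using mem few by (intro add_mono sum_mono) auto
  also have "\<dots> = real (card V) * (p + 2 ^ m * (1 - p / 2) ^ d)"
    by simp
  finally have "(\<Sum>S\<in>Pow V. w S * F S)
      \<le> real (card V) * (p + 2 ^ m * (1 - p / 2) ^ d) * sum w (Pow V)"
    by (simp add: w1)
  then obtain S where "S \<in> Pow V" "F S \<le> real (card V) * (p + 2 ^ m * (1 - p / 2) ^ d)"
    using weighted_average_le[of "Pow V" w F] w0 w1 V by auto
  then show ?thesis
    using that by (auto simp: F_def)
qed

section \<open>Random orientation of the edges between S and its complement\<close>

text \<open>Counting form of conditioning: once the coins outside \<open>B\<close> are exposed, at
  most one outcome on \<open>B\<close> lies in the family, so its probability is at most 2 to the
  power -|B|.\<close>

lemma card_family_determined_outside: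
  assumes "finite A" "B \<subseteq> A" "\<F> \<subseteq> Pow A" "inj_on (\<lambda>X. X - B) \<F>"
  shows "card \<F> * 2 ^ card B \<le> 2 ^ card A"
proof -
  have "card \<F> = card ((\<lambda>X. X - B) ` \<F>)"
    using assms(4) by (simp add: card_image)
  also have "\<dots> \<le> card (Pow (A - B))"
    using assms by (intro card_mono) auto
  also have "\<dots> = 2 ^ (card A - card B)"
    using assms finite_subset by (metis card_Diff_subset card_Pow finite_Diff)
  finally have "card \<F> * 2 ^ card B \<le> 2 ^ (card A - card B) * 2 ^ card B"
    by simp
  also have "\<dots> = 2 ^ card A"
    using assms by (simp add: card_mono flip: power_add)
  finally show ?thesis .
qed

lemma few_undistinguished:
  fixes E :: "('a \<times> 'a) set"
  assumes V: "finite V" and E: "E \<subseteq> V \<times> V" "sym E" and S: "S \<subseteq> V"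
    and Delta: "\<And>u. u \<in> V \<Longrightarrow> card (E `` {u}) \<le> \<Delta>"
  defines "A \<equiv> E \<inter> S \<times> (V - S)"
  obtains X where "X \<subseteq> A"
    "real (card {u \<in> V - S. m \<le> card (S \<inter> E `` {u}) \<and>
        (X\<inverse> `` {u} = {} \<or> (\<exists>v \<in> V - S - {u}. X\<inverse> `` {u} = X\<inverse> `` {v}))})
      \<le> real (card V) * ((1 + real \<Delta> ^ 2) / 2 ^ m)"
proof -
  define U where "U = {u \<in> V - S. m \<le> card (S \<inter> E `` {u})}"
  define bad where "bad X u \<longleftrightarrow> X\<inverse> `` {u} = {} \<or> (\<exists>v \<in> V - S - {u}. X\<inverse> `` {u} = X\<inverse> `` {v})"
    for X :: "('a \<times> 'a) set" and u
  have finE: "finite E"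
    using V E finite_subset by blast
  have finA: "finite A"
    using finE by (simp add: A_def)
  have finU: "finite U" and UV: "U \<subseteq> V"
    using V by (auto simp: U_def)
  \<comment> \<open>The exposed coins are those of edges not ending at u; at least \<open>m\<close>
    coins at u remain, and each family considered leaves them at most one outcome.\<close>
  have part: "card \<F> * 2 ^ m \<le> 2 ^ card A"
    if u: "u \<in> U" and \<F>: "\<F> \<subseteq> Pow A" "inj_on (\<lambda>X. X - S \<times> {u}) \<F>" for u \<F>
  proof -
    define B where "B = A \<inter> S \<times> {u}"
    have "B = (\<lambda>s. (s, u)) ` (S \<inter> E `` {u})"
      using u E(2) S by (auto simp: B_def A_def U_def dest: symD)
    then have cB: "card B = card (S \<inter> E `` {u})"
      by (simp add: card_image inj_on_def)
    have "X - S \<times> {u} = X - B" if "X \<in> \<F>" for X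
      using \<F> that by (auto simp: B_def)
    then have "inj_on (\<lambda>X. X - B) \<F>"
      using \<F>(2) by (simp cong: inj_on_cong)
    then have "card \<F> * 2 ^ card B \<le> 2 ^ card A"
      using card_family_determined_outside[OF finA, of B \<F>] \<F>(1) by (auto simp: B_def)
    moreover have "card \<F> * 2 ^ m \<le> card \<F> * 2 ^ card B"
      using u by (simp add: cB U_def power_increasing)
    ultimately show ?thesis
      by linarith
  qed
  \<comment> \<open>An outcome is recovered from its edges away from u together with the
    in-neighbourhood of u, so any event in which the former determine the latter is covered by
    \<open>part\<close>.\<close>
  have fibre: "X = Y" if "X \<subseteq> A" "Y \<subseteq> A" "X - S \<times> {u} = Y - S \<times> {u}" "X\<inverse> `` {u} = Y\<inverse> `` {u}"
    for X Y u
  proof -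
    have "(a, b) \<in> X \<longleftrightarrow> (a, b) \<in> Y" for a b
    proof (cases "b = u")
      case True
      then show ?thesis
        using that(4) by auto
    next
      case False
      then have "(a, b) \<notin> S \<times> {u}"
        by simp
      then show ?thesis
        using that(3) by blast
    qed
    then show ?thesis
      by auto
  qed
  have "card {X \<in> Pow A. bad X u} * 2 ^ m \<le> (1 + \<Delta>\<^sup>2) * 2 ^ card A" if u: "u \<in> U" for u
  proof -
    define Z where "Z = {X \<in> Pow A. X\<inverse> `` {u} = {}}"
    define T where "T v = {X \<in> Pow A. X\<inverse> `` {u} = X\<inverse> `` {v}}" for v
    \<comment> \<open>The ends of two-step walks from u, other than u: only these can share an
      in-neighbour with u.\<close>
    define W where "W = (\<Union>s \<in> E `` {u}. E `` {s}) - {u}"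
    have uV: "u \<in> V"
      using u UV by auto
    have finW: "finite W"
      using finE by (auto simp: W_def)
    have "card W \<le> card (\<Union>s \<in> E `` {u}. E `` {s})"
      using finE by (intro card_mono) (auto simp: W_def)
    also have "\<dots> \<le> (\<Sum>s \<in> E `` {u}. card (E `` {s}))"
      using finE by (intro card_UN_le) auto
    also have "\<dots> \<le> card (E `` {u}) * \<Delta>"
      using E(1) Delta sum_bounded_above[of "E `` {u}" "\<lambda>s. card (E `` {s})" \<Delta>] by auto
    also have "\<dots> \<le> \<Delta>\<^sup>2"
      using Delta[OF uV] by (simp add: power2_eq_square)
    finally have cW: "card W \<le> \<Delta>\<^sup>2" .
    have Z: "card Z * 2 ^ m \<le> 2 ^ card A"
      using u by (rule part) (auto simp: Z_def intro!: inj_onI fibre)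
    have T: "card (T v) * 2 ^ m \<le> 2 ^ card A" if "v \<in> W" for v
      using u
    proof (rule part)
      show "inj_on (\<lambda>X. X - S \<times> {u}) (T v)"
      proof (rule inj_onI)
        fix X Y
        assume XY: "X \<in> T v" "Y \<in> T v" and eq: "X - S \<times> {u} = Y - S \<times> {u}"
        \<comment> \<open>Since v differs from u, deleting the edges into u leaves the
          in-neighbourhood of v intact. It therefore dictates the in-neighbourhood of u on the event
          \<open>T v\<close>.\<close>
        have "v \<noteq> u"
          using that by (auto simp: W_def)
        then have "X\<inverse> `` {v} = (X - S \<times> {u})\<inverse> `` {v}" "Y\<inverse> `` {v} = (Y - S \<times> {u})\<inverse> `` {v}"
          by auto
        then have "X\<inverse> `` {v} = Y\<inverse> `` {v}"
          using eq by simp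
        then show "X = Y"
          using XY eq by (intro fibre[of X Y u]) (auto simp: T_def)
      qed
    qed (auto simp: T_def)
    have "{X \<in> Pow A. bad X u} \<subseteq> Z \<union> (\<Union>v\<in>W. T v)"
    proof
      fix X
      assume "X \<in> {X \<in> Pow A. bad X u}"
      then have XA: "X \<subseteq> A" and "bad X u"
        by auto
      show "X \<in> Z \<union> (\<Union>v\<in>W. T v)"
      proof (cases "X\<inverse> `` {u} = {}")
        case True
        then show ?thesis
          using XA by (simp add: Z_def)
      next
        case False
        \<comment> \<open>The in-neighbourhood of u is nonempty here, so an equal one at v supplies
          a common in-neighbour s and puts v into \<open>W\<close>.\<close>
        then obtain v s where v: "v \<noteq> u" "X\<inverse> `` {u} = X\<inverse> `` {v}" and s: "(s, u) \<in> X" "(s, v) \<in> X"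
          using \<open>bad X u\<close> unfolding bad_def by blast
        then have "(u, s) \<in> E" "(s, v) \<in> E"
          using XA E(2) by (auto simp: A_def dest: symD)
        then have "v \<in> W"
          using v by (auto simp: W_def)
        then show ?thesis
          using XA v by (auto simp: T_def)
      qed
    qed
    then have "card {X \<in> Pow A. bad X u} \<le> card (Z \<union> (\<Union>v\<in>W. T v))"
      using finA finW by (intro card_mono) (auto simp: Z_def T_def)
    also have "\<dots> \<le> card Z + card (\<Union>v\<in>W. T v)"
      by (rule card_Un_le)
    also have "\<dots> \<le> card Z + (\<Sum>v\<in>W. card (T v))"
      using card_UN_le[OF finW, of T] by simp
    finally have "card {X \<in> Pow A. bad X u} * 2 ^ m \<le> (card Z + (\<Sum>v\<in>W. card (T v))) * 2 ^ m"
      by simp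
    also have "\<dots> = card Z * 2 ^ m + (\<Sum>v\<in>W. card (T v) * 2 ^ m)"
      by (simp add: distrib_right sum_distrib_right)
    also have "\<dots> \<le> 2 ^ card A + (\<Sum>v\<in>W. 2 ^ card A)"
      by (intro add_mono sum_mono Z T)
    also have "\<dots> \<le> 2 ^ card A + \<Delta>\<^sup>2 * 2 ^ card A"
      using cW by simp
    finally show ?thesis
      by simp
  qed
  then have "real (card {X \<in> Pow A. bad X u} * 2 ^ m) \<le> real ((1 + \<Delta>\<^sup>2) * 2 ^ card A)"
    if "u \<in> U" for u
    using that of_nat_le_iff by blast
  then have each: "real (card {X \<in> Pow A. bad X u}) \<le> (1 + real \<Delta> ^ 2) / 2 ^ m * 2 ^ card A"
    if "u \<in> U" for u
    using that by (simp add: field_simps)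
  \<comment> \<open>Double counting of bad pairs (X, u), written with constant weight 1 to fit the
    averaging lemma.\<close>
  have "(\<Sum>X\<in>Pow A. 1 * real (card {u \<in> U. bad X u})) = (\<Sum>X\<in>Pow A. \<Sum>u\<in>U. of_bool (bad X u))"
    using finU by (simp add: of_bool_def sum.If_cases Int_def)
  also have "\<dots> = (\<Sum>u\<in>U. \<Sum>X\<in>Pow A. of_bool (bad X u))"
    by (rule sum.swap)
  also have "\<dots> = (\<Sum>u\<in>U. real (card {X \<in> Pow A. bad X u}))"
    using finA by (simp add: of_bool_def sum.If_cases Int_def)
  also have "\<dots> \<le> (\<Sum>u\<in>U. (1 + real \<Delta> ^ 2) / 2 ^ m * 2 ^ card A)"
    by (intro sum_mono each)
  also have "\<dots> \<le> real (card V) * ((1 + real \<Delta> ^ 2) / 2 ^ m * 2 ^ card A)"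
    using card_mono[OF V UV] unfolding sum_constant by (intro mult_right_mono) auto
  also have "\<dots> = real (card V) * ((1 + real \<Delta> ^ 2) / 2 ^ m) * (\<Sum>X\<in>Pow A. 1)"
    using finA by (simp add: card_Pow)
  finally obtain X where "X \<in> Pow A"
    "real (card {u \<in> U. bad X u}) \<le> real (card V) * ((1 + real \<Delta> ^ 2) / 2 ^ m)"
    using weighted_average_le[of "Pow A" "\<lambda>_. 1" "\<lambda>X. real (card {u \<in> U. bad X u})"
        "real (card V) * ((1 + real \<Delta> ^ 2) / 2 ^ m)"] finA
    by (auto simp: card_Pow)
  moreover have "{u \<in> U. bad X u} = {u \<in> V - S. m \<le> card (S \<inter> E `` {u}) \<and>
        (X\<inverse> `` {u} = {} \<or> (\<exists>v \<in> V - S - {u}. X\<inverse> `` {u} = X\<inverse> `` {v}))}"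
    by (auto simp: U_def bad_def)
  ultimately show ?thesis
    using that by auto
qed

section \<open>From the cut to an orientation and a locating-dominating set\<close>

text \<open>Cut edges outside X are turned towards S. Edges inside S or inside its complement follow
  an arbitrary orientation \<open>D0\<close>, since they contribute no in-neighbour in S to a vertex
  outside S.\<close>

lemma orientation_with_cut:
  assumes G: "pair_graph G"
    and X: "X \<subseteq> parcs G \<inter> S \<times> (pverts G - S)"
  obtains D where "orientation_of D G"
    "\<And>u. u \<in> pverts G - S \<Longrightarrow> in_nbrs D u \<inter> S = X\<inverse> `` {u}"
proof -
  interpret pair_graph G by (rule G)
  obtain D0 where "orientation_of D0 G"
    using orientation_exists[OF G] ..
  then have D0: "parcs D0 \<union> (parcs D0)\<inverse> = parcs G" "parcs D0 \<inter> (parcs D0)\<inverse> = {}"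
    by (simp_all add: orientation_of_def)
  define D where "D = \<lparr>pverts = pverts G, parcs = X
    \<union> {(u, s). (s, u) \<in> parcs G \<inter> S \<times> (pverts G - S) - X}
    \<union> {(u, v). (u, v) \<in> parcs D0 \<and> (u \<in> S \<longleftrightarrow> v \<in> S)}\<rparr>"
  have sym: "(v, u) \<in> parcs G" if "(u, v) \<in> parcs G" for u v
    using pair_sym_arcs that by (auto simp: symmetric_def dest: symD)
  have verts: "u \<in> pverts G" "v \<in> pverts G" if "(u, v) \<in> parcs G" for u v
    using that wellformed' by auto
  have D0G: "(u, v) \<in> parcs G \<longleftrightarrow> (u, v) \<in> parcs D0 \<or> (v, u) \<in> parcs D0" for u v
    using D0(1) by (metis Un_iff converse_iff)
  have D0a: "\<not> ((u, v) \<in> parcs D0 \<and> (v, u) \<in> parcs D0)" for u v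
    using D0(2) by blast
  have D: "(u, v) \<in> parcs D \<longleftrightarrow> (u, v) \<in> X \<or>
      ((v, u) \<in> parcs G \<and> v \<in> S \<and> u \<in> pverts G \<and> u \<notin> S \<and> (v, u) \<notin> X) \<or>
      ((u, v) \<in> parcs D0 \<and> (u \<in> S \<longleftrightarrow> v \<in> S))" for u v
    by (auto simp: D_def)
  have XD: "(u, v) \<in> parcs G \<and> u \<in> S \<and> v \<notin> S" if "(u, v) \<in> X" for u v
    using that X by auto
  have "parcs D \<union> (parcs D)\<inverse> = parcs G"
  proof -
    have "(u, v) \<in> parcs D \<or> (v, u) \<in> parcs D \<longleftrightarrow> (u, v) \<in> parcs G" for u v
      using D[of u v] D[of v u] XD[of u v] XD[of v u] sym[of u v] sym[of v u]
        verts[of u v] D0G[of u v]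
      by argo
    then show ?thesis
      by auto
  qed
  moreover have "parcs D \<inter> (parcs D)\<inverse> = {}"
  proof -
    have "\<not> ((u, v) \<in> parcs D \<and> (v, u) \<in> parcs D)" for u v
      using D[of u v] D[of v u] XD[of u v] XD[of v u] D0a[of u v] by argo
    then show ?thesis
      by auto
  qed
  ultimately have "orientation_of D G"
    by (simp add: orientation_of_def D_def)
  moreover have "in_nbrs D u \<inter> S = X\<inverse> `` {u}" if "u \<in> pverts G - S" for u
    using that XD by (auto simp: in_nbrs_def D)
  ultimately show ?thesis
    using that by blast
qed

lemma oriented_gamma_LD_le:
  assumes "orientation_of D G" "locating_dominating D S"
  shows "oriented_gamma_LD G \<le> card S"
proof -
  have "gamma_LD D \<le> card S"
    unfolding gamma_LD_def using assms(2) by (intro Least_le) auto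
  moreover have "oriented_gamma_LD G \<le> gamma_LD D"
    unfolding oriented_gamma_LD_def using assms(1) by (intro Least_le) auto
  ultimately show ?thesis
    by simp
qed

lemma oriented_gamma_LD_le_card_verts:
  assumes "pair_graph G"
  shows "oriented_gamma_LD G \<le> card (pverts G)"
proof -
  obtain D where "orientation_of D G"
    using orientation_exists[OF assms] ..
  then show ?thesis
    using oriented_gamma_LD_le[OF _ locating_dominating_verts] by (metis orientation_of_def)
qed

lemma out_degree_with_proj:
  "out_degree (with_proj G) u = card (parcs G `` {u})"
proof -
  have "out_arcs (with_proj G) u = Pair u ` (parcs G `` {u})"
    by (auto simp: out_arcs_def)
  then show ?thesis
    by (simp add: out_degree_def card_image inj_on_def)
qed

text \<open>The two random choices are made one after the other. All vertices with too few
  neighbours in S (\<open>P\<close>) and all remaining bad ones (\<open>Q\<close>) then join S; the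
  first two summands pay for S and \<open>P\<close>, the third for \<open>Q\<close>.\<close>

lemma oriented_gamma_LD_bound:
  fixes p :: real
  assumes G: "pair_graph G" and p: "0 \<le> p" "p \<le> 1"
  shows "real (oriented_gamma_LD G) \<le> real (card (pverts G)) *
    (p + 2 ^ m * (1 - p / 2) ^ min_degree G + (1 + real (max_degree G) ^ 2) / 2 ^ m)"
proof -
  interpret pair_graph G by (rule G)
  let ?V = "pverts G" and ?E = "parcs G"
  have V: "finite ?V"
    by simp
  have E: "?E \<subseteq> ?V \<times> ?V"
    using wellformed' by auto
  have symE: "sym ?E"
    using pair_sym_arcs by (simp add: symmetric_def)
  have deg: "min_degree G \<le> card (?E `` {u})" "card (?E `` {u}) \<le> max_degree G" if "u \<in> ?V" for u
    using that by (auto simp: min_degree_def max_degree_def out_degree_with_proj)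
  obtain S where S: "S \<subseteq> ?V"
    and cS: "real (card S) + real (card {u \<in> ?V. card (S \<inter> ?E `` {u}) < m})
      \<le> real (card ?V) * (p + 2 ^ m * (1 - p / 2) ^ min_degree G)"
    using sparse_multiply_dominating_set[of ?V p "\<lambda>u. ?E `` {u}" "min_degree G" m] V p E deg(1)
    by blast
  let ?bad = "\<lambda>X u. X\<inverse> `` {u} = {} \<or> (\<exists>v \<in> ?V - S - {u}. X\<inverse> `` {u} = X\<inverse> `` {v})"
  obtain X where X: "X \<subseteq> ?E \<inter> S \<times> (?V - S)"
    and cX: "real (card {u \<in> ?V - S. m \<le> card (S \<inter> ?E `` {u}) \<and> ?bad X u})
      \<le> real (card ?V) * ((1 + real (max_degree G) ^ 2) / 2 ^ m)"
    using few_undistinguished[OF V E symE S deg(2)] by blast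
  obtain D where D: "orientation_of D G"
    and nb: "\<And>u. u \<in> ?V - S \<Longrightarrow> in_nbrs D u \<inter> S = X\<inverse> `` {u}"
    using orientation_with_cut[OF G X] by blast
  define P where "P = {u \<in> ?V. card (S \<inter> ?E `` {u}) < m}"
  define Q where "Q = {u \<in> ?V - S. m \<le> card (S \<inter> ?E `` {u}) \<and> ?bad X u}"
  have good: "u \<in> ?V - S" "\<not> ?bad X u" if "u \<in> ?V - (S \<union> P \<union> Q)" for u
    using that by (auto simp: P_def Q_def)
  have "locating_dominating D (S \<union> P \<union> Q)"
    unfolding locating_dominating_def
  proof (intro conjI ballI impI)
    have "pverts D = ?V"
      using D by (simp add: orientation_of_def)
    note [simp] = this
    show "S \<union> P \<union> Q \<subseteq> pverts D"
      using S by (auto simp: P_def Q_def)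
    fix u assume u: "u \<in> pverts D - (S \<union> P \<union> Q)"
    then have u': "in_nbrs D u \<inter> S = X\<inverse> `` {u}"
      using nb good(1) by simp
    show "in_nbrs D u \<inter> (S \<union> P \<union> Q) \<noteq> {}"
      using u' good(2)[of u] u by auto
    fix v assume v: "v \<in> pverts D - (S \<union> P \<union> Q)" "u \<noteq> v"
    then have v': "in_nbrs D v \<inter> S = X\<inverse> `` {v}"
      using nb good(1) by simp
    \<comment> \<open>Badness of u compares it with every v outside S, not only with v of high
      degree into S, so goodness of u alone separates the pair. The difference is visible inside S
      and survives the enlargement.\<close>
    have "X\<inverse> `` {u} \<noteq> X\<inverse> `` {v}"
      using good(2)[of u] good(1)[of v] u v by auto
    then show "in_nbrs D u \<inter> (S \<union> P \<union> Q) \<noteq> in_nbrs D v \<inter> (S \<union> P \<union> Q)"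
      using u' v' by blast
  qed
  then have "oriented_gamma_LD G \<le> card (S \<union> P \<union> Q)"
    by (rule oriented_gamma_LD_le[OF D])
  also have "\<dots> \<le> card S + card P + card Q"
    by (meson add_right_mono card_Un_le le_trans)
  finally have "real (oriented_gamma_LD G) \<le> real (card S) + real (card P) + real (card Q)"
    by linarith
  then show ?thesis
    using cS cX unfolding P_def[symmetric] Q_def[symmetric] distrib_left by linarith
qed

section \<open>Choice of the parameters\<close>

text \<open>The bound is stated for minimum degree at least 2 because at degree 0 or 1 its right
  side is 0 (division by zero gives 0), while a nonempty graph has no empty locating-dominating
  set.\<close>

theorem theorem22:
  fixes k :: real and \<G> :: "'a pair_pre_digraph set"
  assumes "k \<ge> 1"
    and "\<And>G. G \<in> \<G> \<Longrightarrow> pair_graph G \<and> pverts G \<noteq> {}"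
    and "\<And>G. G \<in> \<G> \<Longrightarrow> real (max_degree G) \<le> real (min_degree G) powr k"
  shows "\<exists>c :: real. \<forall>G \<in> \<G>. min_degree G \<ge> 2 \<longrightarrow>
           real (oriented_gamma_LD G)
             \<le> c * (log 2 (real (min_degree G)) / real (min_degree G)) * real (card (pverts G))"
proof (intro exI ballI impI)
  fix G
  assume "G \<in> \<G>" and d2: "2 \<le> min_degree G"
  then have G: "pair_graph G" and \<Delta>: "real (max_degree G) \<le> real (min_degree G) powr k"
    using assms by auto
  define d where "d = real (min_degree G)"
  define L where "L = log 2 d"
  define n where "n = real (card (pverts G))"
  \<comment> \<open>Chosen so that 2 ^ m is at least d powr (2 * k + 2): the exponent 2 * k offsets
    the squared maximum degree, one further factor d absorbs the constant in 1 + \<Delta>^2 \<le> 2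
    * d powr (2 * k), and the last one leaves 1 / d.\<close>
  define m where "m = nat \<lceil>(2 * k + 2) * L\<rceil>"
  \<comment> \<open>Makes p * d / 2 equal to 2 * m, so that (1 - p / 2) ^ d is at most exp (- 2 *
    m), hence at most 4 ^ (- m), which beats the factor 2 ^ m.\<close>
  define p where "p = 4 * real m / d"
  have d: "2 \<le> d"
    using d2 by (simp add: d_def)
  have L: "1 \<le> L"
    using d by (simp add: L_def le_log_iff)
  have pos: "0 \<le> (2 * k + 2) * L"
    using assms(1) L by simp
  have m: "(2 * k + 2) * L \<le> real m" "real m \<le> (2 * k + 3) * L"
    using pos L unfolding m_def by (auto simp: algebra_simps of_nat_nat) linarith+
  have "d powr (2 * k + 2) = 2 powr ((2 * k + 2) * L)"
    using d by (simp add: L_def powr_powr[symmetric] mult.commute[of _ "log 2 d"])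
  also have "\<dots> \<le> 2 ^ m"
    using m(1) by (simp add: powr_mono flip: powr_realpow)
  finally have dm: "d powr (2 * k + 2) \<le> 2 ^ m" .
  \<comment> \<open>As L is at least 1, it absorbs both the rounding in \<open>m\<close> and the
    summand 2: 4 * (2 * k + 3) + 2 = 8 * k + 14 is the final constant.\<close>
  have total: "4 * real m + 2 \<le> (8 * k + 14) * L"
    using m(2) L by (simp add: algebra_simps)
  have "real (oriented_gamma_LD G) \<le> n * ((4 * real m + 2) / d)"
  proof (cases "p \<le> 1")
    \<comment> \<open>Here p is no probability, but the claimed bound exceeds the trivial bound
      n.\<close>
    case False
    have "real (oriented_gamma_LD G) \<le> n * 1"
      using oriented_gamma_LD_le_card_verts[OF G] by (simp add: n_def)
    also have "\<dots> \<le> n * ((4 * real m + 2) / d)"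
      using False d by (intro mult_left_mono) (auto simp: p_def n_def field_simps)
    finally show ?thesis .
  next
    case True
    have p0: "0 \<le> p"
      using d by (simp add: p_def)
    have "(1 - p / 2) ^ min_degree G \<le> exp (- (p / 2)) ^ min_degree G"
      using True exp_ge_add_one_self[of "- (p / 2)"] by (intro power_mono) auto
    also have "\<dots> = exp (- 2 * real m)"
      using d by (simp add: p_def d_def flip: exp_of_nat_mult)
    also have "\<dots> = exp (- 2) ^ m"
      by (simp flip: exp_of_nat_mult)
    also have "\<dots> \<le> (1 / 4) ^ m"
    proof (intro power_mono)
      have "(4 :: real) = 2 ^ 2"
        by simp
      also have "\<dots> \<le> exp 1 ^ 2"
        using exp_ge_add_one_self[of 1] by (intro power_mono) auto
      also have "\<dots> = exp 2"
        by (simp flip: exp_of_nat_mult)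
      finally show "exp (- 2) \<le> (1 / 4 :: real)"
        by (simp add: exp_minus field_simps)
    qed simp
    finally have "2 ^ m * (1 - p / 2) ^ min_degree G \<le> 2 ^ m * (1 / 4) ^ m"
      by simp
    also have "\<dots> = (2 * (1 / 4)) ^ m"
      by (rule power_mult_distrib[symmetric])
    also have "\<dots> = 1 / 2 ^ m"
      by (simp add: power_divide)
    also have "\<dots> \<le> 1 / d"
    proof -
      have "d powr 1 \<le> d powr (2 * k + 2)"
        using d assms(1) by (intro powr_mono) auto
      then show ?thesis
        using dm d by (intro divide_left_mono) auto
    qed
    finally have first: "2 ^ m * (1 - p / 2) ^ min_degree G \<le> 1 / d" .
    have "real (max_degree G) ^ 2 \<le> (d powr k) ^ 2"
      using \<Delta> by (intro power_mono) (auto simp: d_def)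
    also have "\<dots> = d powr (2 * k)"
      using d by (simp add: power2_eq_square flip: powr_add)
    finally have "1 + real (max_degree G) ^ 2 \<le> 2 * d powr (2 * k)"
      using d assms(1) ge_one_powr_ge_zero[of d "2 * k"] by simp
    also have "\<dots> \<le> d * d powr (2 * k)"
      using d by (intro mult_right_mono) auto
    finally have "d * (1 + real (max_degree G) ^ 2) \<le> d * (d * d powr (2 * k))"
      using d by (intro mult_left_mono) auto
    also have "\<dots> = d powr (2 * k + 2)"
      using d by (simp add: powr_add power2_eq_square)
    also note dm
    finally have "(1 + real (max_degree G) ^ 2) / 2 ^ m \<le> 1 / d"
      using d by (simp add: field_simps)
    then have "p + 2 ^ m * (1 - p / 2) ^ min_degree G + (1 + real (max_degree G) ^ 2) / 2 ^ m
        \<le> (4 * real m + 2) / d"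
      using first by (simp add: p_def add_divide_distrib)
    then show ?thesis
      using oriented_gamma_LD_bound[OF G p0 True, of m] unfolding n_def
      by (meson mult_left_mono of_nat_0_le_iff order_trans)
  qed
  also have "\<dots> \<le> n * ((8 * k + 14) * L / d)"
    using total d by (intro mult_left_mono divide_right_mono) (auto simp: n_def)
  finally show "real (oriented_gamma_LD G) \<le> (8 * k + 14)
      * (log 2 (real (min_degree G)) / real (min_degree G)) * real (card (pverts G))"
    by (simp add: n_def L_def d_def mult_ac)
qed

end
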